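(* Let $e,\ell\ge2$ be integers, let $\mathbf{s}=(ez_1,\dots,ez_\ell)$ with $z_j\in\mathbb{Z}_{\ge0}$ and $\min_j z_j=0$, and let $\sigma$ be a partition. Let $\mathcal{A}^\circ=\mathcal{A}(\boldsymbol\emptyset,\mathbf{s})$ be the abacus of the empty $\ell$-partition with charge $\mathbf{s}$; each $e$-period of $\mathcal{A}^\circ$ lies in a single row. For $j=1,\dots,\ell$ let $T_j$ be the increasing sequence of all $k\in\mathbb{N}$ such that the $k$'th $e$-period of $\mathcal{A}^\circ$ lies in row $j$. Then $\tilde b_\sigma\mathcal{A}(\boldsymbol\emptyset,\mathbf{s})=\mathcal{A}(\boldsymbol\lambda,\mathbf{s})$, where $\boldsymbol\lambda=(\lambda^1,\dots,\lambda^\ell)$ is given by $$\lambda^j=\sigma[T_j,e],\qquad 1\le j\le\ell.$$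
   Context: Throughout $e,\ell\ge 2$ are fixed integers and $\mathbb{N}=\{1,2,\dots\}$. For a partition $\sigma=(\sigma_1,\sigma_2,\dots)$ (with infinitely many zero parts) and an increasing sequence of positive integers $X=(x_1,x_2,\dots)$, $\sigma[X,e]=(\sigma_{x_1}^e,\sigma_{x_2}^e,\dots)$, where the exponent $e$ means the part is repeated $e$ times. Abaci. An $\ell$-abacus is a subset $\mathcal{A}\subset\mathbb{Z}\times\{1,\dots,\ell\}$ such that for some $m_-,m_+\in\mathbb{Z}$ and all $j$: $(\beta,j)\in\mathcal{A}$ for all $\beta\le m_-$ and $(\beta,j)\notin\mathcal{A}$ for all $\beta\ge m_+$. Elements $b=(\beta,j)\in\mathcal{A}$ are beads, in column $\beta(b)=\beta$ and row $j(b)=j$ (row 1 is the bottom row); pairs not in $\mathcal{A}$ are spaces. For $\mathbf{s}\in\mathbb{Z}^\ell$ and an $\ell$-partition $\boldsymbol\lambda=(\lambda^1,\dots,\lambda^\ell)$ put $\mathcal{A}(\boldsymbol\lambda,\mathbf{s})=\{(\lambda^j_k+s_j-k+1,j)\mid 1\le j\le\ell,\ k\ge 1\}$. Every $\ell$-abacus is of this form for a unique pair $(\boldsymbol\lambda,\mathbf{s})$; $\mathbf{s}$ is its charge. Periods. The first $e$-period of $\mathcal{A}$ is, if it exists, the sequence of $e$ beads $((\beta_i,j_i))_{i=1,\dots,e}$ with $\beta_{i+1}=\beta_i-1$ and $j_{i+1}\le j_i$ for $1\le i\le e-1$, $\beta_1=\max\{\beta\mid(\beta,j)\in\mathcal{A}\}$,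 and $j_i=\min\{j\mid(\beta_i,j)\in\mathcal{A}\}$ for all $i$. Recursively, the $k$'th $e$-period of $\mathcal{A}$ is, if it exists, the first $e$-period of the abacus obtained by removing the first $k-1$ $e$-periods. Quasiperiods and fore periods. Beads are totally ordered by: $b<b'$ iff $\beta(b)<\beta(b')$, or $\beta(b)=\beta(b')$ and $j(b)>j(b')$. An $e$-quasiperiod (quasiperiod) of $\mathcal{A}$ is a sequence of $e$ beads $(b_1,\dots,b_e)$ with $\beta(b_{i+1})=\beta(b_i)-1$ and $j(b_i)\ge j(b_{i+1})$ for $1\le i\le e-1$. Quasiperiods are ordered lexicographically. The first fore period $P_1$ of $\mathcal{A}$ is its largest quasiperiod; inductively the $k$'th fore period $P_k$ is the largest quasiperiod with $P_k<P_{k-1}$ and $P_k\cap P_i=\emptyset$ for all $i<k$. Shifting $P$ one unit to the right means replacing $\mathcal{A}$ by $(\mathcal{A}\setminus P)\cup\tilde P$, $\tilde P=\{(\beta+1,j)\mid(\beta,j)\in P\}$. The operators $\tilde b_\sigma$. For a partition $\sigma=(\sigma_1\ge\sigma_2\ge\cdots)$, the operator $\tilde b_\sigma$ acts on $\ell$-abaci (preserving charge) by shifting the first fore period (of the current abacus) one unit to the right $\sigma_1$ times, then shifting the second fore period (of the current abacus) one unit to the right $\sigma_2$ times, and so on (these shifts are always defined). *)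

theory Defs
  imports "HOL-Library.Infinite_Set"
begin

text \<open>
  Sequences written from index 1 (parts of partitions, components of charges and of
  \<open>l\<close>-partitions, periods) are functions on \<^typ>\<open>nat\<close>; their value at 0 is never used.
\<close>

definition is_partition :: "(nat \<Rightarrow> nat) \<Rightarrow> bool" where
  "is_partition \<sigma> \<longleftrightarrow> (\<forall>k\<ge>1. \<sigma> (Suc k) \<le> \<sigma> k) \<and> finite {k. 1 \<le> k \<and> \<sigma> k \<noteq> 0}"

definition num_parts :: "(nat \<Rightarrow> nat) \<Rightarrow> nat" where
  "num_parts \<sigma> = card {k. 1 \<le> k \<and> \<sigma> k \<noteq> 0}"

text \<open>
  \<open>repeat_parts \<sigma> X e\<close> is \<open>\<sigma>[X,e]\<close>: the positions \<open>(i - 1) * e + 1, \<dots>, i * e\<close> hold the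
  part of \<open>\<sigma>\<close> with index \<open>X i\<close>.
\<close>

definition repeat_parts :: "(nat \<Rightarrow> nat) \<Rightarrow> (nat \<Rightarrow> nat) \<Rightarrow> nat \<Rightarrow> nat \<Rightarrow> nat" where
  "repeat_parts \<sigma> X e k = \<sigma> (X ((k - 1) div e + 1))"

text \<open>The increasing sequence of all elements of an infinite set, indexed from 1.\<close>

definition increasing_seq :: "nat set \<Rightarrow> nat \<Rightarrow> nat" where
  "increasing_seq S i = enumerate S (i - 1)"


type_synonym bead = "int \<times> nat"
type_synonym abacus = "bead set"

abbreviation column :: "bead \<Rightarrow> int" where "column \<equiv> fst"
abbreviation row :: "bead \<Rightarrow> nat" where "row \<equiv> snd"

definition abacus_of :: "nat \<Rightarrow> (nat \<Rightarrow> nat \<Rightarrow> nat) \<Rightarrow> (nat \<Rightarrow> int) \<Rightarrow> abacus" where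
  "abacus_of l lam s = {(int (lam j k) + s j - int k + 1, j) | j k. j \<in> {1..l} \<and> 1 \<le> k}"

definition empty_multipartition :: "nat \<Rightarrow> nat \<Rightarrow> nat" where
  "empty_multipartition j k = 0"


text \<open>Periods and quasiperiods are lists of beads \<open>[b\<^sub>1, \<dots>, b\<^sub>e]\<close>, so \<open>b\<^sub>i\<close> is \<open>P ! (i - 1)\<close>.\<close>

definition first_period :: "nat \<Rightarrow> abacus \<Rightarrow> bead list \<Rightarrow> bool" where
  "first_period e A P \<longleftrightarrow>
     length P = e \<and> set P \<subseteq> A \<and>
     (\<forall>i. Suc i < e \<longrightarrow> column (P ! Suc i) = column (P ! i) - 1 \<and> row (P ! Suc i) \<le> row (P ! i)) \<and>
     (\<forall>b\<in>A. column b \<le> column (P ! 0)) \<and>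
     (\<forall>i<e. row (P ! i) = (LEAST j. (column (P ! i), j) \<in> A))"

text \<open>In the next definition \<open>F 1, \<dots>, F k\<close> are the first \<open>k\<close> periods of \<open>A\<close>.\<close>

definition kth_period :: "nat \<Rightarrow> abacus \<Rightarrow> nat \<Rightarrow> bead list \<Rightarrow> bool" where
  "kth_period e A k P \<longleftrightarrow>
     1 \<le> k \<and>
     (\<exists>F. F k = P \<and> (\<forall>i\<in>{1..k}. first_period e (A - (\<Union>h\<in>{1..<i}. set (F h))) (F i)))"

definition period_indices :: "nat \<Rightarrow> abacus \<Rightarrow> nat \<Rightarrow> nat set" where
  "period_indices e A j = {k. \<exists>P. kth_period e A k P \<and> (\<forall>b\<in>set P. row b = j)}"


definition bead_less :: "(bead \<times> bead) set" where
  "bead_less = {(b, b'). column b < column b' \<or> column b = column b' \<and> row b > row b'}"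

definition quasiperiod :: "nat \<Rightarrow> abacus \<Rightarrow> bead list \<Rightarrow> bool" where
  "quasiperiod e A P \<longleftrightarrow>
     length P = e \<and> set P \<subseteq> A \<and>
     (\<forall>i. Suc i < e \<longrightarrow> column (P ! Suc i) = column (P ! i) - 1 \<and> row (P ! i) \<ge> row (P ! Suc i))"

definition quasiperiod_less :: "bead list \<Rightarrow> bead list \<Rightarrow> bool" where
  "quasiperiod_less P Q \<longleftrightarrow> (P, Q) \<in> lexord bead_less"

definition largest_of :: "bead list set \<Rightarrow> bead list \<Rightarrow> bool" where
  "largest_of \<P> P \<longleftrightarrow> P \<in> \<P> \<and> (\<forall>Q\<in>\<P>. Q \<noteq> P \<longrightarrow> quasiperiod_less Q P)"

definition is_fore_period :: "nat \<Rightarrow> abacus \<Rightarrow> nat \<Rightarrow> bead list \<Rightarrow> bool" where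
  "is_fore_period e A k P \<longleftrightarrow>
     1 \<le> k \<and>
     (\<exists>F. F k = P \<and>
        (\<forall>i\<in>{1..k}.
           largest_of
             {Q. quasiperiod e A Q \<and> (1 < i \<longrightarrow> quasiperiod_less Q (F (i - 1))) \<and>
                 (\<forall>h\<in>{1..<i}. set Q \<inter> set (F h) = {})}
             (F i)))"

definition fore_period :: "nat \<Rightarrow> abacus \<Rightarrow> nat \<Rightarrow> bead list" where
  "fore_period e A k = (THE P. is_fore_period e A k P)"

definition shift_right :: "bead list \<Rightarrow> abacus \<Rightarrow> abacus" where
  "shift_right P A = (A - set P) \<union> {(\<beta> + 1, j) | \<beta> j. (\<beta>, j) \<in> set P}"

definition shift_fore_period :: "nat \<Rightarrow> nat \<Rightarrow> abacus \<Rightarrow> abacus" where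
  "shift_fore_period e k A = shift_right (fore_period e A k) A"

primrec shift_fore_periods_upto :: "nat \<Rightarrow> (nat \<Rightarrow> nat) \<Rightarrow> nat \<Rightarrow> abacus \<Rightarrow> abacus" where
  "shift_fore_periods_upto e \<sigma> 0 A = A"
| "shift_fore_periods_upto e \<sigma> (Suc n) A =
     (shift_fore_period e (Suc n) ^^ \<sigma> (Suc n)) (shift_fore_periods_upto e \<sigma> n A)"

text \<open>Only the nonzero parts of \<open>\<sigma>\<close> contribute shifts, so the procedure stops after them.\<close>

definition b_tilde :: "nat \<Rightarrow> (nat \<Rightarrow> nat) \<Rightarrow> abacus \<Rightarrow> abacus" where
  "b_tilde e \<sigma> A = shift_fore_periods_upto e \<sigma> (num_parts \<sigma>) A"

end

theory Submission
  imports Defs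
begin

text \<open>
  Cut the beads of \<open>\<A>(\<emptyset>, s)\<close> into blocks of \<open>e\<close> consecutive beads of one row: since \<open>e\<close> divides
  every \<open>s j\<close>, the block of level \<open>m\<close> in row \<open>j\<close> occupies the columns \<open>e * (m - 1) + 1, \<dots>, e * m\<close>,
  where \<open>m \<le> z j\<close>.  Number the blocks \<open>1, 2, \<dots>\<close> by decreasing level and, within one level, by
  increasing row.  Block number \<open>k\<close> is the \<open>k\<close>-th \<open>e\<close>-period (\<open>kth_period_block_iff\<close>).

  For a weakly decreasing sequence \<open>\<tau>\<close> of nonnegative integers let \<open>\<A>\<^sub>\<tau>\<close> be the abacus in which,
  for each \<open>k\<close>, block \<open>k\<close> is moved \<open>\<tau> k\<close> units to the right.  The main point is that the
  \<open>k\<close>-th fore period of \<open>\<A>\<^sub>\<tau>\<close> is exactly its (moved) block \<open>k\<close> (\<open>is_fore_period_block\<close>).  Indeed, let \<open>Q\<close> be a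
  quasiperiod avoiding the blocks before \<open>k\<close>.  No remaining bead is larger than the first
  bead of block \<open>k\<close>.  If \<open>Q\<close> starts at that bead, its rows cannot exceed the row of block \<open>k\<close>;
  they cannot be smaller either, because a later block in a lower row has smaller level and was not moved
  further, so it ends to the left of block \<open>k\<close>.  Hence \<open>Q\<close> is block \<open>k\<close>.

  Starting from \<open>\<tau> = 0\<close>, each of the shifts that make up \<open>b_tilde e \<sigma>\<close> therefore increases
  one \<open>\<tau> k\<close> by one and keeps \<open>\<tau>\<close> weakly decreasing, and the result is \<open>\<A>\<^sub>\<sigma>\<close>
  (\<open>b_tilde_block_abacus\<close>).  In row \<open>j\<close> the blocks have levels \<open>z j, z j - 1, \<dots>\<close>, so the
  \<open>i\<close>-th of them is moved by the part of \<open>\<sigma>\<close> with index \<open>T j i\<close>.  Its \<open>e\<close> beads are those of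
  the \<open>e\<close> equal parts of \<open>\<lambda>\<^sup>j\<close> at positions \<open>(i - 1) * e + 1, \<dots>, i * e\<close>
  (\<open>abacus_of_repeat_parts\<close>).
\<close>

section \<open>Enumerations and partitions\<close>

lemma enumerate_range_strict_mono:
  fixes g :: "nat \<Rightarrow> nat"
  assumes g: "strict_mono g"
  shows "enumerate (range g) n = g n"
proof (induction n)
  case 0
  have "(LEAST s. s \<in> range g) = g 0"
    using g by (intro Least_equality) (auto simp: strict_mono_less_eq)
  then show ?case by (simp add: enumerate_0)
next
  case (Suc n)
  have inf: "infinite (range g)"
    using g by (simp add: range_inj_infinite strict_mono_imp_inj_on)
  have "(LEAST s. s \<in> range g \<and> g n < s) = g (Suc n)"
    using g by (intro Least_equality) (auto simp: strict_mono_less strict_mono_less_eq)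
  then show ?case by (simp add: enumerate_Suc''[OF inf] Suc.IH)
qed

lemma partition_eq_0:
  assumes "is_partition \<sigma>" "num_parts \<sigma> < k"
  shows "\<sigma> k = 0"
proof (rule ccontr)
  assume nz: "\<sigma> k \<noteq> 0"
  let ?S = "{k. 1 \<le> k \<and> \<sigma> k \<noteq> 0}"
  have "\<sigma> k \<le> \<sigma> i" if "1 \<le> i" "i \<le> k" for i
    using that(2,1) assms(1) by (induction rule: dec_induct) (auto simp: is_partition_def intro: order_trans)
  then have "{1..k} \<subseteq> ?S" using nz by fastforce
  then have "card {1..k} \<le> card ?S"
    using assms(1) by (intro card_mono) (auto simp: is_partition_def)
  then show False using assms(2) by (simp add: num_parts_def)
qed

lemma antimono_on_partition:
  assumes "is_partition \<sigma>"
  shows "antimono_on {1..} \<sigma>"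
proof (rule monotone_onI)
  fix i k :: nat assume "i \<in> {1..}" "i \<le> k"
  from this(2,1) assms show "\<sigma> k \<le> \<sigma> i"
    by (induction k rule: dec_induct) (auto simp: is_partition_def intro: order_trans)
qed

lemma is_partition_repeat_parts:
  assumes \<sigma>: "is_partition \<sigma>" and S: "infinite S" "0 \<notin> S" and e: "e \<ge> 1"
  shows "is_partition (repeat_parts \<sigma> (increasing_seq S) e)"
proof -
  let ?r = "repeat_parts \<sigma> (increasing_seq S) e"
  have r: "?r k = \<sigma> (enumerate S ((k - 1) div e))" for k
    by (simp add: repeat_parts_def increasing_seq_def)
  have pos: "enumerate S i \<ge> 1" for i
    using enumerate_in_set[OF S(1), of i] S(2) by (cases "enumerate S i") auto
  have dec: "?r (Suc k) \<le> ?r k" for k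
    unfolding r using S(1) pos
    by (intro monotone_onD[OF antimono_on_partition[OF \<sigma>]]) (auto intro: div_le_mono)
  have "k < e * (num_parts \<sigma> + 1) + 1" if "1 \<le> k" "?r k \<noteq> 0" for k
  proof -
    have "(k - 1) div e \<le> enumerate S ((k - 1) div e)" using le_enumerate[OF S(1)] .
    also have "\<dots> \<le> num_parts \<sigma>" using that partition_eq_0[OF \<sigma>] unfolding r by (meson not_le)
    finally have "(k - 1) div e < num_parts \<sigma> + 1" by simp
    then have "k - 1 < (num_parts \<sigma> + 1) * e" using e by (simp only: div_less_iff_less_mult)
    then show ?thesis by (simp add: mult.commute)
  qed
  then have "{k. 1 \<le> k \<and> ?r k \<noteq> 0} \<subseteq> {..< e * (num_parts \<sigma> + 1) + 1}" by blast
  then show ?thesis using dec unfolding is_partition_def by (meson finite_lessThan finite_subset)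
qed

section \<open>Uniqueness of periods and fore periods\<close>

text \<open>
  The first bead lies in the rightmost occupied column, and each bead is the lowest one of
  its column.
\<close>

lemma first_period_unique:
  assumes P: "first_period e A P" and Q: "first_period e A Q" and e: "e \<ge> 1"
  shows "P = Q"
proof -
  have len: "length P = e" "length Q = e" and sub: "set P \<subseteq> A" "set Q \<subseteq> A"
    using P Q unfolding first_period_def by blast+
  have step: "column (P ! Suc i) = column (P ! i) - 1" "column (Q ! Suc i) = column (Q ! i) - 1"
    if "Suc i < e" for i
    using P Q that unfolding first_period_def by blast+
  have top: "column b \<le> column (P ! 0)" "column b \<le> column (Q ! 0)" if "b \<in> A" for b
    using P Q that unfolding first_period_def by blast+
  have row: "row (P ! i) = (LEAST j. (column (P ! i), j) \<in> A)"
    "row (Q ! i) = (LEAST j. (column (Q ! i), j) \<in> A)" if "i < e" for i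
    using P Q that unfolding first_period_def by blast+
  have "P ! 0 \<in> set P" "Q ! 0 \<in> set Q" using len e by simp_all
  then have "P ! 0 \<in> A" "Q ! 0 \<in> A" using sub by blast+
  then have col0: "column (P ! 0) = column (Q ! 0)"
    by (intro order_antisym top)
  have col: "column (P ! i) = column (Q ! i)" if "i < e" for i
    using that
  proof (induction i)
    case (Suc i)
    then show ?case using step[of i] by simp
  qed (use col0 in simp)
  have "P ! i = Q ! i" if "i < e" for i
    by (rule prod_eqI) (simp_all only: col[OF that] row[OF that])
  then show ?thesis using len by (simp add: nth_equalityI)
qed

lemma quasiperiod_column_row:
  assumes "quasiperiod e A Q" "i < e"
  shows "column (Q ! i) = column (Q ! 0) - int i \<and> row (Q ! i) \<le> row (Q ! 0)"
  using assms(2)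
proof (induction i)
  case (Suc i)
  then have "column (Q ! Suc i) = column (Q ! i) - 1" "row (Q ! Suc i) \<le> row (Q ! i)"
    using assms(1) by (auto simp: quasiperiod_def)
  then show ?case using Suc by auto
qed simp

lemma quasiperiod_less_asym: "quasiperiod_less P Q \<Longrightarrow> \<not> quasiperiod_less Q P"
  unfolding quasiperiod_less_def
  by (rule lexord_asymmetric) (auto simp: bead_less_def intro!: asymI)

lemma quasiperiod_less_of_first:
  assumes "P \<noteq> []" "Q \<noteq> []" "(P ! 0, Q ! 0) \<in> bead_less"
  shows "quasiperiod_less P Q"
  using assms by (cases P; cases Q) (auto simp: quasiperiod_less_def)

lemma largest_of_unique: "largest_of \<P> P \<Longrightarrow> largest_of \<P> Q \<Longrightarrow> P = Q"
  unfolding largest_of_def by (metis quasiperiod_less_asym)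

lemma is_fore_period_unique:
  assumes P: "is_fore_period e A k P" and Q: "is_fore_period e A k Q"
  shows "P = Q"
proof -
  let ?C = "\<lambda>i F. {Q. quasiperiod e A Q \<and> (1 < i \<longrightarrow> quasiperiod_less Q (F (i - 1))) \<and>
                 (\<forall>h\<in>{1..<i}. set Q \<inter> set (F h) = {})}"
  obtain F where F: "F k = P" "\<And>i. i \<in> {1..k} \<Longrightarrow> largest_of (?C i F) (F i)"
    using P unfolding is_fore_period_def by blast
  obtain G where G: "G k = Q" "\<And>i. i \<in> {1..k} \<Longrightarrow> largest_of (?C i G) (G i)"
    using Q unfolding is_fore_period_def by blast
  have "F i = G i" if "i \<in> {1..k}" for i
    using that
  proof (induction i rule: less_induct)
    case (less i)
    have "F h = G h" if "h \<in> {1..<i}" for h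
      using that less by auto
    then have "?C i F = ?C i G"
      by (intro Collect_cong conj_cong imp_cong ball_cong refl) simp_all
    then have "largest_of (?C i F) (G i)" using G(2)[OF less.prems] by (rule ssubst)
    then show ?case by (rule largest_of_unique[OF F(2)[OF less.prems]])
  qed
  moreover have "k \<in> {1..k}" using P by (simp add: is_fore_period_def)
  ultimately show ?thesis using F(1) G(1) by blast
qed

section \<open>Block abaci\<close>

text \<open>
  The \<open>k\<close>-th block, \<open>k \<ge> 1\<close>, has level \<open>level k\<close> and lies in row \<open>line k\<close>.  The assumptions say
  that each pair \<open>(m, j)\<close> with \<open>1 \<le> j \<le> l\<close> and \<open>m \<le> z j\<close> is enumerated, and that the enumeration is
  by decreasing level, then by increasing row.
\<close>

locale block_enumeration =
  fixes e l :: nat and z :: "nat \<Rightarrow> nat" and level :: "nat \<Rightarrow> int" and line :: "nat \<Rightarrow> nat"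
  assumes e: "e \<ge> 1"
    and line: "k \<ge> 1 \<Longrightarrow> line k \<in> {1..l}"
    and level_le: "k \<ge> 1 \<Longrightarrow> level k \<le> int (z (line k))"
    and ex_block: "j \<in> {1..l} \<Longrightarrow> m \<le> int (z j) \<Longrightarrow> \<exists>k\<ge>1. level k = m \<and> line k = j"
    and order: "1 \<le> i \<Longrightarrow> i < k \<Longrightarrow> level k < level i \<or> level k = level i \<and> line i < line k"
begin

lemma block_index_inj:
  "1 \<le> i \<Longrightarrow> 1 \<le> k \<Longrightarrow> level i = level k \<Longrightarrow> line i = line k \<Longrightarrow> i = k"
  using order[of i k] order[of k i] by (cases i k rule: linorder_cases) auto

text \<open>Block number \<open>k\<close>, moved \<open>\<tau> k\<close> units to the right and listed from right to left.\<close>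

definition block :: "(nat \<Rightarrow> nat) \<Rightarrow> nat \<Rightarrow> bead list" where
  "block \<tau> k = map (\<lambda>i. (int e * level k + int (\<tau> k) - int i, line k)) [0..<e]"

text \<open>The abacus \<open>\<A>\<^sub>\<tau>\<close> made of all the moved blocks.\<close>

definition block_abacus :: "(nat \<Rightarrow> nat) \<Rightarrow> abacus" where
  "block_abacus \<tau> = (\<Union>k\<in>{1..}. set (block \<tau> k))"

lemma length_block [simp]: "length (block \<tau> k) = e"
  by (simp add: block_def)

lemma nth_block [simp]:
  "i < e \<Longrightarrow> block \<tau> k ! i = (int e * level k + int (\<tau> k) - int i, line k)"
  by (simp add: block_def)

lemma block_not_Nil [simp]: "block \<tau> k \<noteq> []"
  using e by (simp add: block_def)

lemma block_cong: "\<tau> k = \<tau>' k \<Longrightarrow> block \<tau> k = block \<tau>' k"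
  by (simp add: block_def)

lemma mem_block_iff:
  "(c, j) \<in> set (block \<tau> k) \<longleftrightarrow>
     j = line k \<and> int e * level k + int (\<tau> k) - int e < c \<and> c \<le> int e * level k + int (\<tau> k)"
  (is "_ \<longleftrightarrow> ?R")
proof
  assume ?R
  then show "(c, j) \<in> set (block \<tau> k)"
    by (auto simp: block_def image_iff intro!: bexI[of _ "nat (int e * level k + int (\<tau> k) - c)"])
qed (auto simp: block_def)

lemma set_block_subset: "k \<ge> 1 \<Longrightarrow> set (block \<tau> k) \<subseteq> block_abacus \<tau>"
  by (auto simp: block_abacus_def)

lemma level_less_mult: "level h < level k \<Longrightarrow> int e * level h \<le> int e * level k - int e"
  using mult_left_mono[of "level h" "level k - 1" "int e"] by (simp add: right_diff_distrib)

context
  fixes \<tau> :: "nat \<Rightarrow> nat"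
  assumes \<tau>: "antimono_on {1..} \<tau>"
begin

lemma antitone: "1 \<le> i \<Longrightarrow> i \<le> k \<Longrightarrow> \<tau> k \<le> \<tau> i"
  by (rule monotone_onD[OF \<tau>]) auto

lemma block_disjoint_less:
  assumes "1 \<le> k" "k < h"
  shows "set (block \<tau> k) \<inter> set (block \<tau> h) = {}"
proof -
  have False if "(c, j) \<in> set (block \<tau> k)" "(c, j) \<in> set (block \<tau> h)" for c j
  proof -
    have "line k = line h" and c: "int e * level k + int (\<tau> k) - int e < c" "c \<le> int e * level h + int (\<tau> h)"
      using that unfolding mem_block_iff by metis+
    then have "level h < level k" using order[OF assms] by simp
    then have "int e * level h \<le> int e * level k - int e" by (rule level_less_mult)
    moreover have "\<tau> h \<le> \<tau> k" using antitone[of k h] assms by simp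
    ultimately show False using c by linarith
  qed
  then show ?thesis by (metis disjoint_iff surj_pair)
qed

lemma block_disjoint:
  "1 \<le> k \<Longrightarrow> 1 \<le> h \<Longrightarrow> k \<noteq> h \<Longrightarrow> set (block \<tau> k) \<inter> set (block \<tau> h) = {}"
  by (metis block_disjoint_less Int_commute nat_neq_iff)

lemma block_abacus_diff:
  assumes "1 \<le> k"
  shows "block_abacus \<tau> - (\<Union>h\<in>{1..<k}. set (block \<tau> h)) = (\<Union>h\<in>{k..}. set (block \<tau> h))"
proof -
  have "set (block \<tau> i) \<inter> set (block \<tau> h) = {}" if "i \<in> {1..<k}" "h \<in> {k..}" for i h
    using that by (intro block_disjoint) auto
  then have "(\<Union>h\<in>{1..<k}. set (block \<tau> h)) \<inter> (\<Union>h\<in>{k..}. set (block \<tau> h)) = {}"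
    by blast
  moreover have "{1..} = {1..<k} \<union> {k..}" using assms by auto
  then have "block_abacus \<tau> = (\<Union>h\<in>{1..<k}. set (block \<tau> h)) \<union> (\<Union>h\<in>{k..}. set (block \<tau> h))"
    by (simp only: block_abacus_def UN_Un)
  ultimately show ?thesis by blast
qed

text \<open>
  All beads of the blocks \<open>h \<ge> k\<close> lie weakly to the left of the first bead of block \<open>k\<close>, and
  those in the columns of block \<open>k\<close> do not lie below it.
\<close>

lemma later_block_column_row:
  assumes k: "1 \<le> k" "k \<le> h" and mem: "(c, j) \<in> set (block \<tau> h)"
  shows "c \<le> int e * level k + int (\<tau> k)"
    and "int e * level k + int (\<tau> k) - int e < c \<Longrightarrow> line k \<le> j"
proof -
  have "level h < level k \<or> level h = level k \<and> line k \<le> line h"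
    using order[of k h] k by (cases "k = h") auto
  moreover have "\<tau> h \<le> \<tau> k" using antitone k by simp
  ultimately show "c \<le> int e * level k + int (\<tau> k)"
    and "int e * level k + int (\<tau> k) - int e < c \<Longrightarrow> line k \<le> j"
    using mem level_less_mult[of h k] by (auto simp: mem_block_iff)
qed

lemma quasiperiod_block:
  assumes "1 \<le> k"
  shows "quasiperiod e (block_abacus \<tau>) (block \<tau> k)"
  using set_block_subset[OF assms] by (auto simp: quasiperiod_def)

lemma quasiperiod_less_block:
  assumes k: "1 \<le> k" and Q: "quasiperiod e (block_abacus \<tau>) Q"
    and disj: "\<And>h. h \<in> {1..<k} \<Longrightarrow> set Q \<inter> set (block \<tau> h) = {}"
    and neq: "Q \<noteq> block \<tau> k"
  shows "quasiperiod_less Q (block \<tau> k)"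
proof -
  let ?c = "int e * level k + int (\<tau> k)"
  have len: "length Q = e" using Q by (simp add: quasiperiod_def)
  have later: "\<exists>h\<ge>k. Q ! i \<in> set (block \<tau> h)" if "i < e" for i
  proof -
    have "Q ! i \<in> set Q" "set Q \<subseteq> block_abacus \<tau>"
      using Q len that by (auto simp: quasiperiod_def)
    then have "Q ! i \<in> block_abacus \<tau> - (\<Union>h\<in>{1..<k}. set (block \<tau> h))"
      using disj by blast
    then show ?thesis by (auto simp only: block_abacus_diff[OF k] UN_iff atLeast_iff)
  qed
  have le: "column (Q ! i) \<le> ?c" and row: "?c - int e < column (Q ! i) \<Longrightarrow> line k \<le> row (Q ! i)"
    if "i < e" for i
    using later[OF that] later_block_column_row[OF k, of _ "column (Q ! i)" "row (Q ! i)"] by auto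
  have "Q ! 0 \<noteq> (?c, line k)"
  proof
    assume first: "Q ! 0 = (?c, line k)"
    have "Q ! i = block \<tau> k ! i" if "i < e" for i
      using quasiperiod_column_row[OF Q that] row[OF that] that first by (auto simp: prod_eq_iff)
    then have "Q = block \<tau> k" using len by (simp add: list_eq_iff_nth_eq)
    then show False using neq by simp
  qed
  then have "(Q ! 0, block \<tau> k ! 0) \<in> bead_less"
    using le[of 0] row[of 0] e by (cases "Q ! 0") (auto simp: bead_less_def)
  moreover have "Q \<noteq> []" using len e by auto
  ultimately show ?thesis by (intro quasiperiod_less_of_first) auto
qed

lemma block_less_block:
  assumes "1 \<le> i" "i < k"
  shows "quasiperiod_less (block \<tau> k) (block \<tau> i)"
proof (rule quasiperiod_less_block)
  show "set (block \<tau> k) \<inter> set (block \<tau> h) = {}" if "h \<in> {1..<i}" for h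
    using that assms by (intro block_disjoint) auto
  show "block \<tau> k \<noteq> block \<tau> i"
    using block_disjoint[of k i] assms by auto
qed (use assms quasiperiod_block in auto)

text \<open>
  The condition \<open>P\<^sub>k < P\<^sub>k\<^sub>-\<^sub>1\<close> on fore periods excludes nothing here: a quasiperiod that
  avoids the blocks before \<open>k\<close> is smaller than block \<open>k - 1\<close> by \<open>quasiperiod_less_block\<close>.
\<close>

lemma is_fore_period_block:
  assumes "1 \<le> k"
  shows "is_fore_period e (block_abacus \<tau>) k (block \<tau> k)"
  unfolding is_fore_period_def
proof (intro conjI exI[of _ "block \<tau>"] ballI)
  fix i assume i: "i \<in> {1..k}"
  show "largest_of {Q. quasiperiod e (block_abacus \<tau>) Q \<and>
      (1 < i \<longrightarrow> quasiperiod_less Q (block \<tau> (i - 1))) \<and>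
      (\<forall>h\<in>{1..<i}. set Q \<inter> set (block \<tau> h) = {})} (block \<tau> i)"
    (is "largest_of ?C _")
    unfolding largest_of_def
  proof (intro conjI ballI impI)
    have "set (block \<tau> i) \<inter> set (block \<tau> h) = {}" if "h \<in> {1..<i}" for h
      using that by (intro block_disjoint) auto
    moreover have "1 < i \<Longrightarrow> quasiperiod_less (block \<tau> i) (block \<tau> (i - 1))"
      by (intro block_less_block) auto
    ultimately show "block \<tau> i \<in> ?C" using quasiperiod_block i by simp
    show "quasiperiod_less Q (block \<tau> i)" if "Q \<in> ?C" "Q \<noteq> block \<tau> i" for Q
      using that i by (intro quasiperiod_less_block) auto
  qed
qed (use assms in auto)

lemma fore_period_block: "1 \<le> k \<Longrightarrow> fore_period e (block_abacus \<tau>) k = block \<tau> k"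
  unfolding fore_period_def
  by (rule the_equality, rule is_fore_period_block, assumption,
      rule is_fore_period_unique[OF _ is_fore_period_block])

lemma shift_fore_period_block_abacus:
  assumes k: "1 \<le> k"
  shows "shift_fore_period e k (block_abacus \<tau>) = block_abacus (\<tau>(k := Suc (\<tau> k)))"
proof -
  let ?\<tau> = "\<tau>(k := Suc (\<tau> k))"
  have other: "block ?\<tau> h = block \<tau> h" if "h \<noteq> k" for h
    using that by (intro block_cong) simp
  have moved: "{(c + 1, j) | c j. (c, j) \<in> set (block \<tau> k)} = set (block ?\<tau> k)"
  proof -
    have "(c, j) \<in> set (block ?\<tau> k) \<longleftrightarrow> (c - 1, j) \<in> set (block \<tau> k)" for c j
      by (auto simp: mem_block_iff)
    then show ?thesis by (auto simp: image_iff) (metis diff_add_cancel)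
  qed
  have split: "{1..} = insert k ({1..} - {k})" using k by auto
  have "block_abacus \<tau> - set (block \<tau> k) = (\<Union>h\<in>{1..} - {k}. set (block \<tau> h))"
    using block_disjoint[OF k] by (auto simp: block_abacus_def)
  also have "\<dots> = (\<Union>h\<in>{1..} - {k}. set (block ?\<tau> h))"
    using other by auto
  finally have "shift_right (block \<tau> k) (block_abacus \<tau>) =
      (\<Union>h\<in>{1..} - {k}. set (block ?\<tau> h)) \<union> set (block ?\<tau> k)"
    unfolding shift_right_def moved by simp
  also have "\<dots> = block_abacus ?\<tau>"
    unfolding block_abacus_def by (subst (2) split) auto
  finally show ?thesis by (simp add: shift_fore_period_def fore_period_block[OF k])
qed

end

text \<open>
  While fore period \<open>n + 1\<close> is being shifted, it has been moved at most
  \<open>\<sigma> (n + 1)\<close> units and the earlier ones at least as far, so the sequence of shifts remains weakly decreasing.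
\<close>

lemma shift_fore_periods_upto_block_abacus:
  assumes \<sigma>: "antimono_on {1..} \<sigma>"
  shows "shift_fore_periods_upto e \<sigma> n (block_abacus (\<lambda>_. 0)) =
    block_abacus (\<lambda>k. if k \<in> {1..n} then \<sigma> k else 0)"
proof (induction n)
  case (Suc n)
  let ?\<tau> = "\<lambda>k. if k \<in> {1..n} then \<sigma> k else 0"
  have "(shift_fore_period e (Suc n) ^^ t) (block_abacus ?\<tau>) = block_abacus (?\<tau>(Suc n := t))"
    if "t \<le> \<sigma> (Suc n)" for t
    using that
  proof (induction t)
    case 0
    have "?\<tau>(Suc n := 0) = ?\<tau>" by auto
    then show ?case by simp
  next
    case (Suc t)
    have "antimono_on {1..} (?\<tau>(Suc n := t))"
    proof (rule monotone_onI)
      fix i k :: nat assume ik: "i \<in> {1..}" "k \<in> {1..}" "i \<le> k"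
      have "\<sigma> k \<le> \<sigma> i" "i \<le> Suc n \<Longrightarrow> \<sigma> (Suc n) \<le> \<sigma> i"
        using ik monotone_onD[OF \<sigma>, of i k] monotone_onD[OF \<sigma>, of i "Suc n"] by auto
      then show "(?\<tau>(Suc n := t)) k \<le> (?\<tau>(Suc n := t)) i"
        using ik Suc.prems by auto
    qed
    moreover have "1 \<le> Suc n" by simp
    ultimately have "shift_fore_period e (Suc n) (block_abacus (?\<tau>(Suc n := t))) =
        block_abacus ((?\<tau>(Suc n := t))(Suc n := Suc ((?\<tau>(Suc n := t)) (Suc n))))"
      by (rule shift_fore_period_block_abacus)
    then have "shift_fore_period e (Suc n) (block_abacus (?\<tau>(Suc n := t))) =
        block_abacus (?\<tau>(Suc n := Suc t))"
      by (simp only: fun_upd_upd fun_upd_same)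
    moreover have "(shift_fore_period e (Suc n) ^^ t) (block_abacus ?\<tau>) = block_abacus (?\<tau>(Suc n := t))"
      using Suc.prems by (intro Suc.IH) simp
    ultimately show ?case by (simp only: funpow.simps comp_apply)
  qed
  moreover have "?\<tau>(Suc n := \<sigma> (Suc n)) = (\<lambda>k. if k \<in> {1..Suc n} then \<sigma> k else 0)"
    by auto
  ultimately show ?case using Suc.IH by simp
qed simp

lemma b_tilde_block_abacus:
  assumes "is_partition \<sigma>"
  shows "b_tilde e \<sigma> (block_abacus (\<lambda>_. 0)) = block_abacus \<sigma>"
proof -
  let ?\<tau> = "\<lambda>k. if k \<in> {1..num_parts \<sigma>} then \<sigma> k else 0"
  have "block ?\<tau> k = block \<sigma> k" if "k \<ge> 1" for k
    using that partition_eq_0[OF assms, of k] by (intro block_cong) auto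
  then have "block_abacus ?\<tau> = block_abacus \<sigma>" by (auto simp: block_abacus_def)
  then show ?thesis
    using shift_fore_periods_upto_block_abacus[OF antimono_on_partition[OF assms]]
    by (simp add: b_tilde_def)
qed

section \<open>Periods of the unshifted abacus\<close>

lemma first_period_block:
  assumes k: "1 \<le> k"
  shows "first_period e (block_abacus (\<lambda>_. 0) - (\<Union>h\<in>{1..<k}. set (block (\<lambda>_. 0) h)))
    (block (\<lambda>_. 0) k)"
proof -
  let ?B = "block (\<lambda>_. 0)"
  let ?A = "\<Union>h\<in>{k..}. set (?B h)"
  have zero: "antimono_on {1..} (\<lambda>_. 0 :: nat)" by (rule antimono_on_const)
  have "line k = (LEAST j. (int e * level k - int i, j) \<in> ?A)" if "i < e" for i
  proof (rule Least_equality[symmetric])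
    show "(int e * level k - int i, line k) \<in> ?A"
      using that by (auto intro!: bexI[of _ k] simp: mem_block_iff)
    show "line k \<le> j" if "(int e * level k - int i, j) \<in> ?A" for j
      using that later_block_column_row(2)[OF zero k] \<open>i < e\<close> by auto
  qed
  moreover have "column b \<le> int e * level k" if "b \<in> ?A" for b
    using that later_block_column_row(1)[OF zero k] by (cases b) auto
  ultimately have "first_period e ?A (?B k)"
    using e by (auto simp: first_period_def)
  then show ?thesis by (simp only: block_abacus_diff[OF zero k])
qed

lemma kth_period_block_iff:
  "kth_period e (block_abacus (\<lambda>_. 0)) k P \<longleftrightarrow> 1 \<le> k \<and> P = block (\<lambda>_. 0) k"
proof
  let ?B = "block (\<lambda>_. 0)" and ?A = "block_abacus (\<lambda>_. 0)"
  assume P: "kth_period e ?A k P"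
  then have k: "1 \<le> k" by (simp add: kth_period_def)
  obtain F where F: "F k = P"
    "\<And>i. i \<in> {1..k} \<Longrightarrow> first_period e (?A - (\<Union>h\<in>{1..<i}. set (F h))) (F i)"
    using P unfolding kth_period_def by blast
  have "F i = ?B i" if "i \<in> {1..k}" for i
    using that
  proof (induction i rule: less_induct)
    case (less i)
    then have "(\<Union>h\<in>{1..<i}. set (F h)) = (\<Union>h\<in>{1..<i}. set (?B h))" by auto
    then show ?case
      using F(2)[OF less.prems] first_period_block[of i] less.prems e
      by (metis atLeastAtMost_iff first_period_unique)
  qed
  then show "1 \<le> k \<and> P = ?B k" using k F(1) by auto
next
  assume "1 \<le> k \<and> P = block (\<lambda>_. 0) k"
  then show "kth_period e (block_abacus (\<lambda>_. 0)) k P"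
    unfolding kth_period_def
    by (intro conjI exI[of _ "block (\<lambda>_. 0)"] ballI first_period_block) auto
qed

lemma period_indices_block_abacus:
  "period_indices e (block_abacus (\<lambda>_. 0)) j = {k. 1 \<le> k \<and> line k = j}"
proof -
  have "set (block \<tau> k) = (\<lambda>i. (int e * level k + int (\<tau> k) - int i, line k)) ` {..<e}" for \<tau> k
    by (auto simp: block_def)
  moreover have "{..<e} \<noteq> {}" using e by (auto simp: lessThan_empty_iff)
  ultimately show ?thesis
    by (auto simp: period_indices_def kth_period_block_iff)
qed

section \<open>Block abaci and multipartitions\<close>

text \<open>The \<open>q\<close>-th block in row \<open>j\<close>, counted from \<open>q = 0\<close>, has level \<open>z j - q\<close>.\<close>

lemma line_enumeration:
  assumes j: "j \<in> {1..l}"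
  shows "infinite {k. 1 \<le> k \<and> line k = j}"
    and "level (enumerate {k. 1 \<le> k \<and> line k = j} q) = int (z j) - int q"
proof -
  have "\<exists>k\<ge>1. level k = int (z j) - int q \<and> line k = j" for q
    using ex_block[OF j] by simp
  then obtain g where g: "\<And>q. 1 \<le> g q \<and> level (g q) = int (z j) - int q \<and> line (g q) = j"
    by metis
  have mono: "strict_mono g"
  proof (rule strict_monoI, rule ccontr)
    fix p q :: nat assume "p < q" "\<not> g p < g q"
    then show False using order[of "g q" "g p"] g[of p] g[of q] by (cases "g p = g q") auto
  qed
  have "k \<in> range g" if "1 \<le> k" "line k = j" for k
  proof (rule range_eqI, rule block_index_inj)
    show "level k = level (g (nat (int (z j) - level k)))"
      using g[of "nat (int (z j) - level k)"] level_le[of k] that by simp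
  qed (use that g in simp_all)
  then have "{k. 1 \<le> k \<and> line k = j} = range g" using g by auto
  then show "infinite {k. 1 \<le> k \<and> line k = j}"
    and "level (enumerate {k. 1 \<le> k \<and> line k = j} q) = int (z j) - int q"
    using mono g by (auto simp: enumerate_range_strict_mono range_inj_infinite strict_mono_imp_inj_on)
qed

lemma abacus_of_repeat_parts:
  assumes s: "\<forall>j\<in>{1..l}. s j = int e * int (z j)"
    and lam: "\<And>j k. j \<in> {1..l} \<Longrightarrow>
      lam j k = repeat_parts \<tau> (increasing_seq {k. 1 \<le> k \<and> line k = j}) e k"
  shows "abacus_of l lam s = block_abacus \<tau>"
proof -
  let ?E = "\<lambda>j. enumerate {k. 1 \<le> k \<and> line k = j}"
  have lam': "lam j k = \<tau> (?E j ((k - 1) div e))" if "j \<in> {1..l}" for j k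
    using lam[OF that] by (simp add: repeat_parts_def increasing_seq_def)
  have E: "1 \<le> ?E j q" "line (?E j q) = j" if "j \<in> {1..l}" for j q
    using enumerate_in_set[OF line_enumeration(1)[OF that], of q] by auto
  \<comment> \<open>Part \<open>q * e + i + 1\<close> of the partition in row \<open>j\<close> gives the bead number \<open>i\<close> of the block
    of level \<open>z j - q\<close> in that row.\<close>
  have bead: "int (lam j (q * e + i + 1)) + s j - int (q * e + i + 1) + 1 =
      int e * level (?E j q) + int (\<tau> (?E j q)) - int i"
    if "j \<in> {1..l}" "i < e" for j q i
  proof -
    have "(q * e + i + 1 - 1) div e = q" using that(2) by simp
    then have part: "lam j (q * e + i + 1) = \<tau> (?E j q)" by (simp only: lam'[OF that(1)])
    have "int e * level (?E j q) = s j - int (q * e)"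
      unfolding line_enumeration(2)[OF that(1)] using s that(1)
      by (simp add: right_diff_distrib mult.commute)
    then show ?thesis unfolding part by simp
  qed
  show ?thesis
  proof (intro set_eqI iffI; clarify)
    fix c j assume "(c, j) \<in> abacus_of l lam s"
    then obtain k where k: "1 \<le> k" "j \<in> {1..l}" "c = int (lam j k) + s j - int k + 1"
      by (auto simp: abacus_of_def)
    define q i where "q = (k - 1) div e" and "i = (k - 1) mod e"
    have i: "i < e" and kq: "k = q * e + i + 1" using k(1) e by (auto simp: q_def i_def)
    have "c = int e * level (?E j q) + int (\<tau> (?E j q)) - int i"
      using bead[OF k(2) i] k(3) kq by simp
    then have "(c, j) \<in> set (block \<tau> (?E j q))"
      using i E(2)[OF k(2)] by (simp add: mem_block_iff)
    then show "(c, j) \<in> block_abacus \<tau>"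
      using set_block_subset[OF E(1)[OF k(2)]] by blast
  next
    fix c j assume "(c, j) \<in> block_abacus \<tau>"
    then obtain k i where k: "1 \<le> k" "i < e" "j = line k"
      "c = int e * level k + int (\<tau> k) - int i"
      by (auto simp: block_abacus_def block_def)
    have j: "j \<in> {1..l}" using line k by simp
    define q where "q = nat (int (z j) - level k)"
    have "?E j q = k"
    proof (rule block_index_inj)
      show "level (?E j q) = level k"
        unfolding line_enumeration(2)[OF j] q_def using k(3) level_le[OF k(1)] by simp
    qed (use E[OF j] k in simp_all)
    then have "c = int (lam j (q * e + i + 1)) + s j - int (q * e + i + 1) + 1"
      using bead[OF j k(2), of q] k(4) by simp
    then show "(c, j) \<in> abacus_of l lam s"
      unfolding abacus_of_def using j by fastforce
  qed
qed

end

section \<open>Existence of the enumeration of the blocks\<close>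

text \<open>
  With \<open>M\<close> an upper bound of the \<open>z j\<close>, the block of level \<open>m\<close> in row \<open>j\<close> gets the key
  \<open>l * (M - m) + (j - 1)\<close>; enumerating the keys in increasing order gives the required order.
\<close>

lemma block_enumeration_exists:
  fixes z :: "nat \<Rightarrow> nat"
  assumes e: "e \<ge> 1" and l: "l \<ge> 1"
  obtains level line where "block_enumeration e l z level line"
proof -
  define M where "M = Max (z ` {1..l})"
  have M: "z j \<le> M" if "j \<in> {1..l}" for j using that by (simp add: M_def)
  define lev where "lev n = int M - int (n div l)" for n
  define lin where "lin n = Suc (n mod l)" for n
  define K where "K = {n. lev n \<le> int (z (lin n))}"
  have "l * M + i \<in> K" for i
    using l by (auto simp: K_def lev_def)
  then have "(\<lambda>i. l * M + i) ` UNIV \<subseteq> K" by auto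
  moreover have "inj (\<lambda>i. l * M + i)" by (simp add: inj_def)
  ultimately have inf: "infinite K" by (meson infinite_super range_inj_infinite)
  let ?k = "\<lambda>k. enumerate K (k - 1)"
  have "block_enumeration e l z (\<lambda>k. lev (?k k)) (\<lambda>k. lin (?k k))"
  proof
    show "1 \<le> e" by (fact e)
    fix k :: nat assume "1 \<le> k"
    show "lin (?k k) \<in> {1..l}" using l by (simp add: lin_def Suc_leI)
    show "lev (?k k) \<le> int (z (lin (?k k)))"
      using enumerate_in_set[OF inf] by (auto simp: K_def)
  next
    fix j m assume jm: "j \<in> {1..l}" "m \<le> int (z j)"
    obtain j' where j': "j = Suc j'" "j' < l" using jm(1) by (cases j) auto
    define n where "n = l * nat (int M - m) + j'"
    have n: "lev n = m" "lin n = j"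
      using jm(2) M[OF jm(1)] j' by (auto simp: n_def lev_def lin_def)
    then have "n \<in> K" using jm by (simp add: K_def)
    then obtain i where "enumerate K i = n" using enumerate_Ex[OF inf] by blast
    then show "\<exists>k\<ge>1. lev (?k k) = m \<and> lin (?k k) = j"
      using n by (intro exI[of _ "Suc i"]) simp
  next
    fix i k :: nat assume "1 \<le> i" "i < k"
    then have less: "?k i < ?k k" using inf by (intro enumerate_mono) auto
    have "lev b < lev a \<or> lev b = lev a \<and> lin a < lin b" if "a < b" for a b
    proof (cases "a div l = b div l")
      case True
      then have "a mod l < b mod l"
        using that by (metis add_less_cancel_left div_mult_mod_eq)
      with True show ?thesis by (simp add: lev_def lin_def)
    next
      case False
      then show ?thesis using div_le_mono[of a b l] that by (simp add: lev_def)
    qed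
    from this[OF less]
    show "lev (?k k) < lev (?k i) \<or> lev (?k k) = lev (?k i) \<and> lin (?k i) < lin (?k k)" .
  qed
  then show ?thesis by (rule that)
qed

section \<open>The abacus obtained from the empty multipartition\<close>

theorem theorem5p1:
  fixes e l :: nat and z :: "nat \<Rightarrow> nat" and s :: "nat \<Rightarrow> int" and \<sigma> :: "nat \<Rightarrow> nat"
    and A0 :: abacus and T :: "nat \<Rightarrow> nat \<Rightarrow> nat" and lam :: "nat \<Rightarrow> nat \<Rightarrow> nat"
  assumes "e \<ge> 2" and "l \<ge> 2"
    and "\<forall>j\<in>{1..l}. s j = int e * int (z j)"
    and "Min (z ` {1..l}) = 0"
    and "is_partition \<sigma>"
    and "A0 = abacus_of l empty_multipartition s"
    and "\<forall>j\<in>{1..l}. T j = increasing_seq (period_indices e A0 j)"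
    and "\<forall>j\<in>{1..l}. lam j = repeat_parts \<sigma> (T j) e"
  shows "(\<forall>k\<ge>1. \<exists>P. kth_period e A0 k P) \<and>
         (\<forall>k P. kth_period e A0 k P \<longrightarrow> (\<exists>j\<in>{1..l}. \<forall>b\<in>set P. row b = j)) \<and>
         (\<forall>j\<in>{1..l}. infinite (period_indices e A0 j)) \<and>
         (\<forall>j\<in>{1..l}. is_partition (lam j)) \<and>
         b_tilde e \<sigma> A0 = abacus_of l lam s"
proof -
  have "e \<ge> 1" "l \<ge> 1" using assms(1,2) by auto
  then obtain level line where "block_enumeration e l z level line"
    by (rule block_enumeration_exists)
  then interpret block_enumeration e l z level line .
  have A0: "A0 = block_abacus (\<lambda>_. 0)"
    unfolding assms(6)
    by (rule abacus_of_repeat_parts[OF assms(3)]) (simp add: empty_multipartition_def repeat_parts_def)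
  note indices = period_indices_block_abacus[folded A0]
  have lam: "lam j = repeat_parts \<sigma> (increasing_seq {k. 1 \<le> k \<and> line k = j}) e" if "j \<in> {1..l}" for j
    using assms(7,8) that by (simp add: indices)
  have "\<exists>j\<in>{1..l}. \<forall>b\<in>set P. row b = j" if "kth_period e A0 k P" for k P
  proof (rule bexI[of _ "line k"])
    show "\<forall>b\<in>set P. row b = line k"
      using that by (auto simp: A0 kth_period_block_iff mem_block_iff)
    show "line k \<in> {1..l}" using that line by (simp add: A0 kth_period_block_iff)
  qed
  moreover have "is_partition (lam j)" if "j \<in> {1..l}" for j
    unfolding lam[OF that] using assms(5) line_enumeration(1)[OF that] e
    by (intro is_partition_repeat_parts) auto
  moreover have "b_tilde e \<sigma> A0 = abacus_of l lam s"
    using b_tilde_block_abacus[OF assms(5)] abacus_of_repeat_parts[OF assms(3), of lam \<sigma>] lam A0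
    by simp
  ultimately show ?thesis
    using line_enumeration(1) by (auto simp: A0 kth_period_block_iff indices[unfolded A0])
qed

end
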